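(* Let $E\subset\mathbb{N}_{+}$ be a set all of whose elements are even, and put $A=\mathbb{N}_{+}\setminus E$. Then for all $k,n\in\mathbb{N}$ we have $(-1)^{n}S_{A,k}(n)\geq 0$.
   Context: $\mathbb{N}$ is the set of non-negative integers and $\mathbb{N}_{+}$ the set of positive integers. For $A\subset\mathbb{N}_{+}$ and $i,n\in\mathbb{N}$, $c_{A}(i,n)$ denotes the number of $A$-compositions of $n$ with exactly $i$ parts, i.e. the number of (ordered) sequences $(\lambda_{1},\ldots,\lambda_{i})$ with all $\lambda_{j}\in A$ and $\lambda_{1}+\cdots+\lambda_{i}=n$ (so $c_A(0,0)=1$ and $c_A(0,n)=0$ for $n\ge 1$). For $k,n\in\mathbb{N}$ put $$S_{A,k}(n)=\sum_{i=0}^{n}(-1)^{i}i^{k}c_{A}(i,n),$$ with the convention $0^{0}=1$. *)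

theory Defs
  imports Main
begin

definition compositions :: "nat set \<Rightarrow> nat \<Rightarrow> nat \<Rightarrow> nat list set" where
  "compositions A i n = {xs. length xs = i \<and> set xs \<subseteq> A \<and> sum_list xs = n}"

(* Finiteness guarantees that the cardinality used below is a genuine count. *)
lemma finite_compositions: "finite (compositions A i n)"
proof (rule finite_subset)
  show "compositions A i n \<subseteq> {xs. set xs \<subseteq> {..n} \<and> length xs = i}"
    using member_le_sum_list by (fastforce simp: compositions_def)
  show "finite {xs. set xs \<subseteq> {..n} \<and> length xs = i}"
    by (rule finite_lists_length_eq) simp
qed

definition num_compositions :: "nat set \<Rightarrow> nat \<Rightarrow> nat \<Rightarrow> nat" where
  "num_compositions A i n = card (compositions A i n)"

(* For i = k = 0 the factor int i ^ k is 1, in accordance with the convention 0^0 = 1. *)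
definition S :: "nat set \<Rightarrow> nat \<Rightarrow> nat \<Rightarrow> int" where
  "S A k n = (\<Sum>i = 0..n. (- 1) ^ i * int i ^ k * int (num_compositions A i n))"

end

theory Submission
  imports Defs "HOL-Computational_Algebra.Formal_Power_Series"
begin

text \<open>
  Attach to a composition of \<open>n\<close> with \<open>i\<close> parts the sign \<open>(-1)^(n + i)\<close>. This sign is
  multiplicative over the parts, a part \<open>a\<close> contributing \<open>(-1)^(a + 1)\<close>, so with
  \<open>g = (\<Sum>a\<in>A. (-1)^(a + 1) X^a)\<close> the number \<open>(-1)^n S A k n\<close> is the coefficient of \<open>X^n\<close>
  in \<open>(\<Sum>i. i^k g^i)\<close>, that is, in the composition of \<open>(\<Sum>i. i^k X^i)\<close> with \<open>g\<close>
  (\<open>signed_S_eq_compose\<close>).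

  The case \<open>k = 0\<close>: here the series is \<open>h = 1/(1 - g)\<close>. As the elements of \<open>E\<close> are even,
  \<open>1 - g = 1/(1 + X) - e\<close>, where \<open>e\<close> is the generating function of \<open>E\<close>. Hence
  \<open>h = (1 + X)/(1 - (1 + X) e)\<close>, which visibly has nonnegative coefficients.

  General \<open>k\<close>: the series \<open>(\<Sum>i. i^k X^i)\<close> arises from \<open>u = 1/(1 - X)\<close> by applying the Euler
  derivation \<open>F \<mapsto> X F'\<close> \<open>k\<close> times. With \<open>v = u - 1\<close> both \<open>X u'\<close> and \<open>X v'\<close> are equal to \<open>u v\<close>, so
  by Leibniz' rule the sums of products of \<open>u\<close> and \<open>v\<close> are stable under this derivation
  (\<open>geom_cone_euler\<close>). Substituting \<open>g\<close> turns \<open>u\<close> and \<open>v\<close> into \<open>h\<close> and \<open>h - 1\<close>. As \<open>h\<close> has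
  constant term 1, both have nonnegative coefficients, and so do all sums of products of them.
\<close>

unbundle fps_syntax

section \<open>Signed generating functions of compositions\<close>

lemma num_compositions_0: "num_compositions A 0 n = (if n = 0 then 1 else 0)"
proof -
  have "compositions A 0 n = (if n = 0 then {[]} else {})"
    by (auto simp: compositions_def)
  then show ?thesis by (simp add: num_compositions_def)
qed

lemma num_compositions_Suc:
  "num_compositions A (Suc i) n = (\<Sum>a\<in>A \<inter> {0..n}. num_compositions A i (n - a))"
proof -
  have "compositions A (Suc i) n = (\<Union>a\<in>A \<inter> {0..n}. (#) a ` compositions A i (n - a))"
  proof (intro equalityI subsetI)
    fix xs assume "xs \<in> compositions A (Suc i) n"
    then show "xs \<in> (\<Union>a\<in>A \<inter> {0..n}. (#) a ` compositions A i (n - a))"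
      by (cases xs) (auto simp: compositions_def intro!: bexI[of _ "hd xs"])
  qed (auto simp: compositions_def)
  also have "card \<dots> = (\<Sum>a\<in>A \<inter> {0..n}. card ((#) a ` compositions A i (n - a)))"
    by (rule card_UN_disjoint) (auto simp: finite_compositions)
  also have "\<dots> = (\<Sum>a\<in>A \<inter> {0..n}. num_compositions A i (n - a))"
    by (simp add: card_image num_compositions_def)
  finally show ?thesis by (simp add: num_compositions_def)
qed

definition signed_gf :: "nat set \<Rightarrow> int fps" where
  "signed_gf A = Abs_fps (\<lambda>a. if a \<in> A then (- 1) ^ (a + 1) else 0)"

lemma signed_gf_power_nth:
  "(signed_gf A ^ i) $ n = (- 1) ^ (n + i) * int (num_compositions A i n)"
proof (induction i arbitrary: n)
  case 0
  then show ?case by (simp add: num_compositions_0)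
next
  case (Suc i)
  have "(signed_gf A ^ Suc i) $ n =
      (\<Sum>a=0..n. signed_gf A $ a * ((- 1) ^ (n - a + i) * int (num_compositions A i (n - a))))"
    by (simp add: fps_mult_nth Suc.IH)
  also have "\<dots> = (\<Sum>a=0..n. if a \<in> A
      then (- 1) ^ (n + Suc i) * int (num_compositions A i (n - a)) else 0)"
  proof (rule sum.cong)
    fix a assume "a \<in> {0..n}"
    then have "(- 1) ^ (a + 1) * (- 1) ^ (n - a + i) = (- 1 :: int) ^ (n + Suc i)"
      by (simp flip: power_add)
    then show "signed_gf A $ a * ((- 1) ^ (n - a + i) * int (num_compositions A i (n - a))) =
        (if a \<in> A then (- 1) ^ (n + Suc i) * int (num_compositions A i (n - a)) else 0)"
      by (simp add: signed_gf_def flip: mult.assoc)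
  qed simp
  also have "\<dots> = (\<Sum>a\<in>A \<inter> {0..n}. (- 1) ^ (n + Suc i) * int (num_compositions A i (n - a)))"
    by (simp only: Int_commute[of A] sum.inter_restrict finite_atLeastAtMost)
  also have "\<dots> = (- 1) ^ (n + Suc i) * int (num_compositions A (Suc i) n)"
    by (simp only: num_compositions_Suc of_nat_sum sum_distrib_left)
  finally show ?case .
qed

lemma signed_S_eq_compose:
  "(- 1) ^ n * S A k n = (Abs_fps (\<lambda>i. int i ^ k) oo signed_gf A) $ n"
  by (simp add: S_def fps_compose_nth signed_gf_power_nth sum_distrib_left power_add mult_ac)

section \<open>Power moments of the geometric series\<close>

definition geom :: "int fps" where
  "geom = Abs_fps (\<lambda>_. 1)"

lemma geom_mult: "geom * (1 - fps_X) = 1"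
  by (rule fps_ext) (simp add: geom_def algebra_simps)

text \<open>
  The sums of products of \<open>geom\<close> and \<open>geom - 1\<close>. Subtraction is confined to the generator
  \<open>geom - 1\<close>, so that nonnegativity of coefficients passes from the two generators to all members.
\<close>

inductive geom_cone :: "int fps \<Rightarrow> bool" where
  geom: "geom_cone geom"
| geom_minus_1: "geom_cone (geom - 1)"
| add: "geom_cone F \<Longrightarrow> geom_cone G \<Longrightarrow> geom_cone (F + G)"
| mult: "geom_cone F \<Longrightarrow> geom_cone G \<Longrightarrow> geom_cone (F * G)"

lemma euler_geom: "fps_X * fps_deriv geom = geom * (geom - 1)"
proof -
  have "fps_deriv (geom * (1 - fps_X)) = 0"
    by (simp only: geom_mult fps_deriv_1)
  then have d: "fps_deriv geom * (1 - fps_X) = geom"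
    by (simp add: algebra_simps)
  have "fps_deriv geom = fps_deriv geom * (geom * (1 - fps_X))"
    by (simp only: geom_mult mult_1_right)
  also have "\<dots> = geom * (fps_deriv geom * (1 - fps_X))"
    by (simp only: mult_ac)
  finally have "fps_deriv geom = geom * geom"
    by (simp only: d)
  moreover have "fps_X * geom = geom - 1"
    using geom_mult by (simp add: algebra_simps)
  ultimately show ?thesis
    by (metis mult.assoc mult.commute)
qed

text \<open>
  By Leibniz' rule it suffices to look at the two generators, and they have the same derivative.
\<close>

lemma geom_cone_euler: "geom_cone F \<Longrightarrow> geom_cone (fps_X * fps_deriv F)"
proof (induction rule: geom_cone.induct)
  case geom
  show ?case unfolding euler_geom by (intro geom_cone.intros)
next
  case geom_minus_1
  show ?case by (simp add: euler_geom geom_cone.intros)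
next
  case (add F G)
  then show ?case by (simp add: distrib_left geom_cone.add)
next
  case (mult F G)
  have "fps_X * fps_deriv (F * G) = F * (fps_X * fps_deriv G) + (fps_X * fps_deriv F) * G"
    by (simp add: algebra_simps)
  then show ?case using mult by (simp only: geom_cone.add geom_cone.mult)
qed

lemma geom_cone_moments: "geom_cone (Abs_fps (\<lambda>i. int i ^ k))"
proof (induction k)
  case 0
  \<comment> \<open>the coefficient at \<open>i = 0\<close> is 1 by the convention \<open>0^0 = 1\<close>\<close>
  then show ?case using geom_cone.geom by (simp add: geom_def)
next
  case (Suc k)
  have "Abs_fps (\<lambda>i. int i ^ Suc k) = fps_X * fps_deriv (Abs_fps (\<lambda>i. int i ^ k))"
    by (rule fps_ext) simp
  then show ?case using geom_cone_euler[OF Suc] by simp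
qed

section \<open>Nonnegative coefficients\<close>

lemma fps_mult_nth_nonneg:
  fixes F G :: "int fps"
  assumes "\<And>n. F $ n \<ge> 0" "\<And>n. G $ n \<ge> 0"
  shows "(F * G) $ n \<ge> 0"
  by (simp add: fps_mult_nth sum_nonneg assms)

lemma geom_compose:
  assumes "g $ 0 = 0"
  shows "(geom oo g) * (1 - g) = 1"
proof -
  have "(geom oo g) * ((1 - fps_X) oo g) = geom * (1 - fps_X) oo g"
    by (rule fps_compose_mult_distrib[OF assms, symmetric])
  then show ?thesis
    using assms by (simp add: geom_mult fps_compose_sub_distrib)
qed

lemma geom_cone_compose_nonneg:
  assumes "geom_cone F" and g0: "g $ 0 = 0" and nn: "\<And>n. (geom oo g) $ n \<ge> 0"
  shows "(F oo g) $ n \<ge> 0"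
  using assms(1)
proof (induction arbitrary: n rule: geom_cone.induct)
  case geom
  show ?case by (rule nn)
next
  case geom_minus_1
  have "(geom oo g) $ 0 = 1" by (simp add: geom_def fps_compose_nth)
  then show ?case using nn[of n]
    by (cases "n = 0") (simp_all add: fps_compose_sub_distrib)
next
  case (add F G)
  then show ?case by (simp add: fps_compose_add_distrib)
next
  case (mult F G)
  then show ?case by (simp add: fps_compose_mult_distrib[OF g0] fps_mult_nth_nonneg)
qed

text \<open>
  The equation expresses \<open>h $ n\<close> through \<open>p\<close>, \<open>q\<close> and earlier coefficients of \<open>h\<close>;
  it says \<open>h = p/(1 - q)\<close>.
\<close>

lemma fps_nonneg_of_recurrence:
  fixes h p q :: "int fps"
  assumes h: "h = p + h * q" and q0: "q $ 0 = 0"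
    and p: "\<And>n. p $ n \<ge> 0" and q: "\<And>n. q $ n \<ge> 0"
  shows "h $ n \<ge> 0"
proof (induction n rule: less_induct)
  case (less n)
  have "h $ i * q $ (n - i) \<ge> 0" if "i \<in> {0..n}" for i
    using that less q q0 by (cases "i = n") auto
  then have "(h * q) $ n \<ge> 0"
    unfolding fps_mult_nth by (rule sum_nonneg)
  then show ?case
    using p[of n] by (subst h) simp
qed

text \<open>
  If \<open>E\<close> were empty, the geometric series would give \<open>1 - g = 1/(1 + X)\<close>. Removing an even part \<open>e\<close>
  removes the term \<open>- X^e\<close> from \<open>g\<close>, hence subtracts \<open>X^e\<close> from \<open>1 - g\<close>; this is where evenness
  is decisive.
\<close>

lemma geom_compose_signed_gf_nonneg:
  assumes "E \<subseteq> {0<..}" and "\<forall>e\<in>E. even e" and "A = {0<..} - E"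
  shows "(geom oo signed_gf A) $ n \<ge> 0"
proof -
  define g where "g = signed_gf A"
  define h where "h = geom oo g"
  define e :: "int fps" where "e = Abs_fps (\<lambda>n. if n \<in> E then 1 else 0)"
  define alt :: "int fps" where "alt = Abs_fps (\<lambda>n. (- 1) ^ n)"
  have "1 - g = alt - e"
    using assms by (intro fps_ext) (auto simp: g_def signed_gf_def alt_def e_def)
  moreover have "(1 + fps_X) * alt = 1"
  proof (rule fps_ext)
    fix n show "((1 + fps_X) * alt) $ n = (1 :: int fps) $ n"
      by (cases n) (simp_all add: alt_def distrib_right)
  qed
  ultimately have g: "(1 + fps_X) * (1 - g) = 1 - (1 + fps_X) * e"
    by (simp add: right_diff_distrib)
  have "h * (1 - g) = 1"
    unfolding h_def by (rule geom_compose) (simp add: g_def signed_gf_def assms(3))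
  then have "1 + fps_X = h * ((1 + fps_X) * (1 - g))"
    by (metis mult.left_commute mult_1_right)
  then have "h = (1 + fps_X) + h * ((1 + fps_X) * e)"
    unfolding g by (simp add: algebra_simps)
  moreover have "((1 + fps_X) * e) $ 0 = 0"
    using assms(1) by (auto simp: e_def)
  moreover have p: "(1 + fps_X :: int fps) $ m \<ge> 0" for m
    by (simp add: fps_X_def)
  moreover have "((1 + fps_X) * e) $ m \<ge> 0" for m
    by (intro fps_mult_nth_nonneg p) (simp add: e_def)
  ultimately have "h $ n \<ge> 0"
    by (rule fps_nonneg_of_recurrence)
  then show ?thesis by (simp add: h_def g_def)
qed

theorem theorem3p7:
  fixes E A :: "nat set" and k n :: nat
  assumes "E \<subseteq> {0<..}"
    and "\<forall>e\<in>E. even e"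
    and "A = {0<..} - E"
  shows "(- 1) ^ n * S A k n \<ge> 0"
proof -
  have "signed_gf A $ 0 = 0"
    by (simp add: signed_gf_def assms(3))
  then show ?thesis
    unfolding signed_S_eq_compose
    using geom_cone_compose_nonneg[OF geom_cone_moments]
      geom_compose_signed_gf_nonneg[OF assms] by blast
qed

end
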